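(* Let $K$ be an $(\mathrm{I},\mathcal{R},\mathbf{r})$ Cantor set, where $\mathcal{R}=(R_n)_{n\ge0}$ and $\mathbf{r}=(r_{m,n})_{0\le m\le n}$. Suppose $R_n\ge4$ for all $n\ge0$ and that for every $n\ge0$ $$\sum_{k=0}^n\Big(r_{n-k,n}\prod_{i=1}^k\frac{4}{R_{n-i}}\Big)\le\frac{R_n}{4},$$ where the empty product (for $k=0$) equals $1$. Then $$\dim K\ge\liminf_{n\to\infty}\Big(1-\frac{\log 2}{\log R_n}\Big).$$
   Context: $\dim$ denotes Hausdorff dimension. Definition of an $(\mathrm{I},\mathcal{R},\mathbf{r})$ Cantor set: let $\mathrm{I}\subset\mathbb{R}$ be a closed interval, $\mathcal{R}=(R_n)_{n\ge0}$ natural numbers, $\mathbf{r}=(r_{m,n})_{0\le m\le n}$ non-negative reals. Put $\mathcal{J}_0:=\{\mathrm{I}\}$. Given $\mathcal{J}_n$, subdivide each $J\in\mathcal{J}_n$ into $R_n$ closed subintervals of equal length (collection $\mathcal{I}_{n+1}$); then for each $J\in\mathcal{J}_n$ remove at most $r_{n,n}$ of the current intervals lying in $J$, and successively for $k=1,\dots,n$, for each $J\in\mathcal{J}_{n-k}$ remove at most $r_{n-k,n}$ of the current intervals lying in $J$ (choices arbitrary). The remainder is $\mathcal{J}_{n+1}$, and $K=\bigcap_{n\ge1}\bigcup_{J\in\mathcal{J}_n}J$ for some admissible sequence of choices. *)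

theory Defs
  imports "HOL-Analysis.Analysis"
begin

text \<open>The weight \<open>diam(U)\<^sup>s\<close> of a covering set. The case distinction is needed because
  \<open>0 powr 0 = 0\<close>: with it, every nonempty set has weight 1 for \<open>s = 0\<close>, so that the
  0-dimensional measure is the counting measure.\<close>

definition diam_pow :: "real \<Rightarrow> 'a::metric_space set \<Rightarrow> real" where
  "diam_pow s U = (if U = {} then 0 else if s = 0 then 1 else diameter U powr s)"

text \<open>\<^const>\<open>diameter\<close> is only meaningful on bounded sets, hence the explicit
  boundedness requirement. Finite covers are included, as sets in a cover may be empty.\<close>

definition delta_covers :: "real \<Rightarrow> 'a::metric_space set \<Rightarrow> (nat \<Rightarrow> 'a set) set" where
  "delta_covers \<delta> A =
     {U. A \<subseteq> (\<Union>i. U i) \<and> (\<forall>i. bounded (U i) \<and> diameter (U i) \<le> \<delta>)}"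

definition hausdorff_premeasure :: "real \<Rightarrow> real \<Rightarrow> 'a::metric_space set \<Rightarrow> ennreal" where
  "hausdorff_premeasure \<delta> s A =
     (INF U \<in> delta_covers \<delta> A. \<Sum>i. ennreal (diam_pow s (U i)))"

definition hausdorff_measure :: "real \<Rightarrow> 'a::metric_space set \<Rightarrow> ennreal" where
  "hausdorff_measure s A = (SUP \<delta> \<in> {0<..}. hausdorff_premeasure \<delta> s A)"

definition hausdorff_dim :: "'a::metric_space set \<Rightarrow> ereal" where
  "hausdorff_dim A = Inf {ereal s | s. 0 \<le> s \<and> hausdorff_measure s A = 0}"

definition subdivide :: "nat \<Rightarrow> real set \<Rightarrow> real set set" where
  "subdivide N J =
     (\<lambda>i. {Inf J + real i * (Sup J - Inf J) / real N ..
           Inf J + real (Suc i) * (Sup J - Inf J) / real N}) ` {..<N}"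

text \<open>\<open>B\<close> arises from the collection \<open>A\<close> by removing, for each \<open>J \<in> P\<close>, at most \<open>c\<close>
  of the intervals of \<open>A\<close> lying in \<open>J\<close>; \<open>D J\<close> collects those removed on account of \<open>J\<close>.\<close>

definition removal :: "real \<Rightarrow> real set set \<Rightarrow> real set set \<Rightarrow> real set set \<Rightarrow> bool" where
  "removal c P A B \<longleftrightarrow>
     (\<exists>D. (\<forall>J\<in>P. D J \<subseteq> {I \<in> A. I \<subseteq> J} \<and> finite (D J) \<and> real (card (D J)) \<le> c) \<and>
          B = A - (\<Union>J\<in>P. D J))"

text \<open>Here \<open>S k\<close> is the collection of intervals left just before the removals governed by
  \<open>\<J> (n - k)\<close>; in particular \<open>S 0\<close> consists of all the intervals obtained by subdividing
  those in \<open>\<J> n\<close>.\<close>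

definition cantor_construction ::
    "real set \<Rightarrow> (nat \<Rightarrow> nat) \<Rightarrow> (nat \<Rightarrow> nat \<Rightarrow> real) \<Rightarrow> (nat \<Rightarrow> real set set) \<Rightarrow> bool" where
  "cantor_construction I R r \<J> \<longleftrightarrow>
     \<J> 0 = {I} \<and>
     (\<forall>n. \<exists>S. S 0 = (\<Union>J \<in> \<J> n. subdivide (R n) J) \<and>
              (\<forall>k\<le>n. removal (r (n - k) n) (\<J> (n - k)) (S k) (S (Suc k))) \<and>
              \<J> (Suc n) = S (Suc n))"

definition is_cantor_set ::
    "real set \<Rightarrow> (nat \<Rightarrow> nat) \<Rightarrow> (nat \<Rightarrow> nat \<Rightarrow> real) \<Rightarrow> real set \<Rightarrow> bool" where
  "is_cantor_set I R r K \<longleftrightarrow>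
     (\<exists>\<J>. cantor_construction I R r \<J> \<and> K = (\<Inter>n\<in>{1..}. \<Union>(\<J> n)))"

end

theory Submission
  imports Defs
begin

text \<open>No measure on \<open>K\<close> is needed: counting intervals suffices. Let \<open>s\<close> be smaller than the
  lower limit and suppose that \<open>K\<close> is covered by finitely many balls with a small sum of
  \<open>s\<close>-th powers of radii. Let \<open>h\<^sub>n\<close> be the length of the intervals of level \<open>n\<close>. When the
  construction passes from level \<open>n\<close> to level \<open>n + 1\<close>, remove in addition all the intervals meeting
  a ball of radius in \<open>[h\<^bsub>n+1\<^esub>, h\<^sub>n)\<close>. For the number \<open>\<beta>\<^sub>n\<close> of surviving intervals this gives
  \<open>R\<^sub>n \<beta>\<^sub>n \<le> \<beta>\<^bsub>n+1\<^esub> + \<Sum>\<^sub>k r\<^bsub>n-k,n\<^esub> \<beta>\<^bsub>n-k\<^esub> + c\<^sub>n\<close>. Inductively \<open>\<beta>\<^bsub>n+1\<^esub> \<ge> R\<^sub>n \<beta>\<^sub>n / 2\<close>: the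
  induction hypothesis and the hypothesis on \<open>r\<close> bound the sum by \<open>R\<^sub>n \<beta>\<^sub>n / 4\<close>, and the choice of
  \<open>s\<close> bounds the extra loss \<open>c\<^sub>n\<close> by \<open>R\<^sub>n \<beta>\<^sub>n / 4\<close>. So intervals survive at every level, and by
  compactness the balls do not cover \<open>K\<close>.\<close>

section \<open>Grid cells and the number of them that a ball meets\<close>

text \<open>All intervals of level n turn out to be cells of one grid with origin \<open>a\<close>
  and mesh \<open>h n\<close>. Numbering them makes \<open>j div R n\<close> the parent of
  \<open>j\<close>, so collections of intervals become sets of natural numbers.\<close>

definition cell :: "real \<Rightarrow> real \<Rightarrow> nat \<Rightarrow> real set" where
  "cell a h j = {a + real j * h .. a + real (Suc j) * h}"

lemma cell_nonempty: "0 < h \<Longrightarrow> cell a h j \<noteq> {}"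
  by (simp add: cell_def algebra_simps)

text \<open>The midpoint of the smaller cell is an interior point of any cell containing it, and
  distinct cells of one grid have disjoint interiors. A common endpoint would not do, since
  neighbouring cells share one.\<close>

lemma cell_subset_unique:
  assumes "0 < h'" "0 < h" "cell a h' j \<subseteq> cell a h i" "cell a h' j \<subseteq> cell a h i'"
  shows "i = i'"
proof -
  define x where "x = a + (real j + 1/2) * h'"
  have lt: "a + real j * h' < x" "x < a + real (Suc j) * h'"
    using assms(1) by (auto simp: x_def algebra_simps)
  have bounds: "a + real l * h < x \<and> x < a + real (Suc l) * h" if "cell a h' j \<subseteq> cell a h l" for l
  proof -
    have "a + real l * h \<le> a + real j * h'" "a + real (Suc j) * h' \<le> a + real (Suc l) * h"
      using that lt by (auto simp: cell_def)
    then show ?thesis using lt by linarith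
  qed
  have le: "l \<le> m" if "cell a h' j \<subseteq> cell a h l" "cell a h' j \<subseteq> cell a h m" for l m
  proof -
    have "real l * h < real (Suc m) * h"
      using bounds[OF that(1)] bounds[OF that(2)] by linarith
    then have "real l < real (Suc m)"
      using \<open>0 < h\<close> by (simp only: mult_less_cancel_right_pos)
    then show ?thesis by linarith
  qed
  show ?thesis using le assms(3,4) by (meson le_antisym)
qed

lemma inj_cell: "0 < h \<Longrightarrow> inj (cell a h)"
  by (rule injI) (metis cell_subset_unique order_refl)

lemma subdivide_cell:
  assumes "0 < h" "0 < N"
  shows "subdivide N (cell a h j) = cell a (h / real N) ` {i. i div N = j}"
proof -
  have Inf: "Inf (cell a h j) = a + real j * h" and Sup: "Sup (cell a h j) = a + real (Suc j) * h"
    using assms by (simp_all add: cell_def)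
  have "subdivide N (cell a h j) = (\<lambda>i. cell a (h / real N) (j * N + i)) ` {..<N}"
    unfolding subdivide_def Inf Sup
    using assms by (intro image_cong refl) (simp add: cell_def field_simps)
  also have "\<dots> = cell a (h / real N) ` (\<lambda>i. j * N + i) ` {..<N}"
    by (simp add: image_image)
  also have "(\<lambda>i. j * N + i) ` {..<N} = {i. i div N = j}"
  proof (intro equalityI subsetI)
    fix i assume "i \<in> {i. i div N = j}"
    then have "i = j * N + i mod N" "i mod N < N" using assms by auto
    then show "i \<in> (\<lambda>i. j * N + i) ` {..<N}" by blast
  qed (use assms in auto)
  finally show ?thesis .
qed

lemma card_nat_between:
  fixes x y :: real
  assumes "x \<le> y"
  shows "finite {j::nat. x < real j \<and> real j < y}"
    and "real (card {j::nat. x < real j \<and> real j < y}) \<le> y - x + 1"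
proof -
  let ?S = "{j::nat. x < real j \<and> real j < y}"
  have sub: "int ` ?S \<subseteq> {\<lfloor>x\<rfloor> + 1 .. \<lceil>y\<rceil> - 1}"
  proof
    fix z assume "z \<in> int ` ?S"
    then obtain j where "z = int j" "x < real j" "real j < y" by blast
    then have "x < real_of_int z" "real_of_int z < y" by auto
    then show "z \<in> {\<lfloor>x\<rfloor> + 1 .. \<lceil>y\<rceil> - 1}" by (simp; linarith)
  qed
  then have "finite (int ` ?S)" by (rule finite_subset) simp
  then show "finite ?S" by (rule finite_imageD) simp
  have "card ?S = card (int ` ?S)" by (simp add: card_image)
  also have "\<dots> \<le> card {\<lfloor>x\<rfloor> + 1 .. \<lceil>y\<rceil> - 1}" using sub by (intro card_mono) auto
  also have "\<dots> = nat (\<lceil>y\<rceil> - \<lfloor>x\<rfloor> - 1)" by simp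
  finally have "real (card ?S) \<le> real (nat (\<lceil>y\<rceil> - \<lfloor>x\<rfloor> - 1))" by linarith
  \<comment> \<open>\<open>nat\<close> sends a negative difference to 0; in that case
    \<open>x \<le> y\<close> keeps the right-hand side nonnegative.\<close>
  also have "\<dots> \<le> y - x + 1" using assms by linarith
  finally show "real (card ?S) \<le> y - x + 1" .
qed

text \<open>The indices lie in an open interval of length 2\<rho>/h + 1, so there are at most
  2\<rho>/h + 2 of them; \<open>h \<le> \<rho>\<close> absorbs the constant 2 into the factor
  4.\<close>

lemma card_cells_meeting_ball:
  assumes "0 < h" "h \<le> \<rho>"
  shows "finite {j. cell a h j \<inter> ball x \<rho> \<noteq> {}}"
    and "real (card {j. cell a h j \<inter> ball x \<rho> \<noteq> {}}) \<le> 4 * \<rho> / h"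
proof -
  let ?lo = "(x - \<rho> - a) / h - 1" and ?hi = "(x + \<rho> - a) / h"
  have sub: "{j. cell a h j \<inter> ball x \<rho> \<noteq> {}} \<subseteq> {j. ?lo < real j \<and> real j < ?hi}"
  proof
    fix j assume "j \<in> {j. cell a h j \<inter> ball x \<rho> \<noteq> {}}"
    then obtain y where "a + real j * h \<le> y" "y \<le> a + real (Suc j) * h" "\<bar>x - y\<bar> < \<rho>"
      by (auto simp: cell_def dist_real_def)
    then have "real j * h < x + \<rho> - a" "x - \<rho> - a < (real j + 1) * h" by (auto simp: add.commute)
    then show "j \<in> {j. ?lo < real j \<and> real j < ?hi}"
      using \<open>0 < h\<close> by (simp add: pos_less_divide_eq pos_divide_less_eq diff_less_eq)
  qed
  have len: "?hi - ?lo = 2 * \<rho> / h + 1" by (simp add: diff_divide_distrib add_divide_distrib)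
  have one: "1 \<le> \<rho> / h" using assms by simp
  then have "0 \<le> ?hi - ?lo" unfolding len using assms by simp
  then have le: "?lo \<le> ?hi" by linarith
  note fc = card_nat_between[OF le]
  show "finite {j. cell a h j \<inter> ball x \<rho> \<noteq> {}}" using finite_subset[OF sub fc(1)] .
  have "real (card {j. cell a h j \<inter> ball x \<rho> \<noteq> {}}) \<le> ?hi - ?lo + 1"
    using card_mono[OF fc(1) sub] fc(2) by linarith
  also have "\<dots> \<le> 4 * \<rho> / h" unfolding len using one by simp
  finally show "real (card {j. cell a h j \<inter> ball x \<rho> \<noteq> {}}) \<le> 4 * \<rho> / h" .
qed

lemma cell_child_subset:
  assumes "0 < h" "0 < N"
  shows "cell a (h / real N) j \<subseteq> cell a h (j div N)"
proof -
  let ?q = "j div N"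
  have "?q * N \<le> j" "Suc j \<le> Suc ?q * N"
    using dividend_less_div_times[OF assms(2), of j] by (auto simp: div_mult_mod_eq)
  then have "real ?q * real N \<le> real j" "real (Suc j) \<le> real (Suc ?q) * real N"
    by (simp_all only: of_nat_mult[symmetric] of_nat_le_iff)
  then have "real ?q * real N * (h / real N) \<le> real j * (h / real N)"
    "real (Suc j) * (h / real N) \<le> real (Suc ?q) * real N * (h / real N)"
    using assms by (intro mult_right_mono; simp)+
  then have "real ?q * h \<le> real j * (h / real N)" "real (Suc j) * (h / real N) \<le> real (Suc ?q) * h"
    using assms by simp_all
  then show ?thesis by (auto simp: cell_def simp del: of_nat_Suc)
qed

lemma card_div_vimage:
  assumes "finite X" "0 < (N::nat)"
  shows "finite {i. i div N \<in> X}" and "card {i. i div N \<in> X} = N * card X"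
proof -
  let ?f = "\<lambda>(q, t). q * N + t"
  have eq: "{i. i div N \<in> X} = ?f ` (X \<times> {..<N})"
  proof (intro equalityI subsetI)
    fix i assume "i \<in> {i. i div N \<in> X}"
    then have "i = ?f (i div N, i mod N)" "(i div N, i mod N) \<in> X \<times> {..<N}" using assms by auto
    then show "i \<in> ?f ` (X \<times> {..<N})" by blast
  qed auto
  have "inj_on ?f (X \<times> {..<N})"
  proof (rule inj_on_inverseI)
    show "(\<lambda>i. (i div N, i mod N)) (?f z) = z" if "z \<in> X \<times> {..<N}" for z
      using that by auto
  qed
  then show "card {i. i div N \<in> X} = N * card X"
    unfolding eq by (simp add: card_image card_cartesian_product mult.commute)
  show "finite {i. i div N \<in> X}" unfolding eq using assms by simp
qed

section \<open>Compactness, and the construction as arithmetic on indices\<close>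

lemma cantor_construction_step:
  assumes "cantor_construction I R r \<J>"
  obtains S where "S 0 = (\<Union>J \<in> \<J> n. subdivide (R n) J)"
    "\<forall>k\<le>n. removal (r (n - k) n) (\<J> (n - k)) (S k) (S (Suc k))" "\<J> (Suc n) = S (Suc n)"
proof -
  from assms have "\<exists>S. S 0 = (\<Union>J \<in> \<J> n. subdivide (R n) J) \<and>
      (\<forall>k\<le>n. removal (r (n - k) n) (\<J> (n - k)) (S k) (S (Suc k))) \<and> \<J> (Suc n) = S (Suc n)"
    by (simp add: cantor_construction_def)
  then show thesis by (elim exE conjE) (rule that)
qed

lemma removal_subset: "removal c P X Y \<Longrightarrow> Y \<subseteq> X"
  unfolding removal_def by blast

lemma cantor_construction_Suc_subset:
  assumes "cantor_construction I R r \<J>"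
  shows "\<J> (Suc n) \<subseteq> (\<Union>J \<in> \<J> n. subdivide (R n) J)"
proof -
  obtain S where S: "S 0 = (\<Union>J \<in> \<J> n. subdivide (R n) J)"
    "\<forall>k\<le>n. removal (r (n - k) n) (\<J> (n - k)) (S k) (S (Suc k))" "\<J> (Suc n) = S (Suc n)"
    by (rule cantor_construction_step[OF assms])
  have "k \<le> Suc n \<Longrightarrow> S k \<subseteq> S 0" for k
  proof (induction k)
    case (Suc k)
    then have "removal (r (n - k) n) (\<J> (n - k)) (S k) (S (Suc k))" using S(2) by simp
    then show ?case using removal_subset Suc by fastforce
  qed simp
  then show ?thesis using S by blast
qed

lemma cantor_construction_compact:
  assumes "cantor_construction {a..b} R r \<J>"
  shows "compact (\<Union>(\<J> n))"
proof -
  have "finite (\<J> n) \<and> (\<forall>J\<in>\<J> n. compact J)"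
  proof (induction n)
    case 0
    then show ?case using assms by (simp add: cantor_construction_def)
  next
    case (Suc n)
    then have "finite (\<Union>J \<in> \<J> n. subdivide (R n) J)" by (simp add: subdivide_def)
    moreover have "compact J'" if "J' \<in> subdivide (R n) J" for J J'
      using that by (auto simp: subdivide_def)
    ultimately show ?case
      using cantor_construction_Suc_subset[OF assms, of n] finite_subset by blast
  qed
  then show ?thesis by (intro compact_Union) auto
qed

text \<open>Each level is a finite union of compact intervals. Compactness later reduces a countable
  cover by balls to a finite one.\<close>

lemma compact_cantor_set:
  assumes "is_cantor_set {a..b} R r K"
  shows "compact K"
proof -
  obtain \<J> where \<J>: "cantor_construction {a..b} R r \<J>" "K = (\<Inter>n\<in>{1..}. \<Union>(\<J> n))"
    using assms by (auto simp: is_cantor_set_def)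
  then show ?thesis
    using cantor_construction_compact[OF \<J>(1)] by (auto intro!: compact_Inter)
qed

definition indices :: "real \<Rightarrow> (nat \<Rightarrow> real) \<Rightarrow> (nat \<Rightarrow> real set set) \<Rightarrow> nat \<Rightarrow> nat set" where
  "indices a h \<J> n = {j. cell a (h n) j \<in> \<J> n}"

text \<open>This extracts what counting needs: a child of an interval in \<open>A n\<close> either
  belongs to \<open>A (Suc n)\<close> or is charged to an interval \<open>i\<close> of level n - k
  that contains it, and the set \<open>D k i\<close> of children so charged obeys the cardinality
  bound. The order of the removals is forgotten.\<close>

lemma cantor_construction_indices:
  fixes a :: real and h :: "nat \<Rightarrow> real" and \<J> :: "nat \<Rightarrow> real set set"
  defines "A \<equiv> indices a h \<J>"
  assumes constr: "cantor_construction {a..b} R r \<J>" and R: "\<And>n. 0 < R n"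
    and h_pos: "\<And>n. 0 < h n" and h_0: "h 0 = b - a" and h_Suc: "\<And>n. h (Suc n) = h n / real (R n)"
  shows "A 0 = {0}" and "\<J> n = cell a (h n) ` A n" and "A (Suc n) \<subseteq> {j. j div R n \<in> A n}"
    and "\<exists>D. (\<forall>k\<le>n. \<forall>i\<in>A (n - k). finite (D k i) \<and> real (card (D k i)) \<le> r (n - k) n \<and>
               (\<forall>j\<in>D k i. cell a (h (Suc n)) j \<subseteq> cell a (h (n - k)) i)) \<and>
             {j. j div R n \<in> A n} \<subseteq> A (Suc n) \<union> (\<Union>k\<le>n. \<Union>i\<in>A (n - k). D k i)"
proof -
  note A_def = A_def indices_def
  have J0: "\<J> 0 = {cell a (h 0) 0}"
    using constr by (simp add: cantor_construction_def cell_def h_0)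
  note sub = cantor_construction_Suc_subset[OF constr]
  have sub_cells: "(\<Union>J \<in> \<J> n. subdivide (R n) J) = cell a (h (Suc n)) ` {j. j div R n \<in> A n}"
    if "\<J> n = cell a (h n) ` A n" for n
    unfolding that h_Suc by (auto simp: subdivide_cell[OF h_pos R])
  have J: "\<J> n = cell a (h n) ` A n" for n
  proof (induction n)
    case 0
    show ?case using J0 by (auto simp: A_def)
  next
    case (Suc n)
    then show ?case using sub[of n] sub_cells[of n] by (auto simp: A_def)
  qed
  show "A 0 = {0}" using inj_cell[OF h_pos] by (auto simp: A_def J0 dest: injD)
  show "\<J> n = cell a (h n) ` A n" by (rule J)
  show "A (Suc n) \<subseteq> {j. j div R n \<in> A n}"
  proof
    fix j assume "j \<in> A (Suc n)"
    then have "cell a (h (Suc n)) j \<in> cell a (h (Suc n)) ` {j. j div R n \<in> A n}"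
      using sub[of n] sub_cells[OF J] by (auto simp: A_def)
    then show "j \<in> {j. j div R n \<in> A n}" by (simp only: inj_image_mem_iff[OF inj_cell[OF h_pos]])
  qed
  obtain S where S: "S 0 = (\<Union>J \<in> \<J> n. subdivide (R n) J)"
    "\<forall>k\<le>n. removal (r (n - k) n) (\<J> (n - k)) (S k) (S (Suc k))" "\<J> (Suc n) = S (Suc n)"
    by (rule cantor_construction_step[OF constr])
  \<comment> \<open>A witness of \<open>removal\<close> exists separately for each stage; naming its
    property lets \<open>SOME\<close> pick one family \<open>E\<close> for all stages.\<close>
  define removes where "removes k D \<longleftrightarrow> (\<forall>J\<in>\<J> (n - k). D J \<subseteq> {I \<in> S k. I \<subseteq> J} \<and>
      finite (D J) \<and> real (card (D J)) \<le> r (n - k) n) \<and> S (Suc k) = S k - (\<Union>J\<in>\<J> (n - k). D J)" for k D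
  define E where "E k = (SOME D. removes k D)" for k
  have rem: "removes k (E k)" if "k \<le> n" for k
  proof -
    have "\<exists>D. removes k D" using S(2) that by (simp add: removal_def removes_def)
    then show ?thesis unfolding E_def by (rule someI_ex)
  qed
  have E: "E k J \<subseteq> {I \<in> S k. I \<subseteq> J} \<and> finite (E k J) \<and> real (card (E k J)) \<le> r (n - k) n"
    if "k \<le> n" "J \<in> \<J> (n - k)" for k J
    using rem[OF that(1)] that(2) by (simp add: removes_def)
  have ES: "S (Suc k) = S k - (\<Union>J\<in>\<J> (n - k). E k J)" if "k \<le> n" for k
    using rem[OF that] by (simp add: removes_def)
  let ?c = "cell a (h (Suc n))"
  have inj: "inj ?c" by (rule inj_cell[OF h_pos])
  define D where "D k i = ?c -` E k (cell a (h (n - k)) i)" for k i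
  have small: "finite (D k i) \<and> real (card (D k i)) \<le> r (n - k) n \<and>
      (\<forall>j\<in>D k i. ?c j \<subseteq> cell a (h (n - k)) i)" if "k \<le> n" "i \<in> A (n - k)" for k i
  proof -
    have "cell a (h (n - k)) i \<in> \<J> (n - k)" using that by (simp add: A_def)
    note e = E[OF that(1) this]
    have "card (D k i) = card (?c ` D k i)" using inj by (simp add: card_image inj_on_def)
    also have "\<dots> \<le> card (E k (cell a (h (n - k)) i))"
      using e by (intro card_mono) (auto simp: D_def)
    finally have "real (card (D k i)) \<le> r (n - k) n" using e by linarith
    moreover have "finite (D k i)" unfolding D_def using e inj by (intro finite_vimageI) auto
    ultimately show ?thesis using e by (auto simp: D_def)
  qed
  \<comment> \<open>A child outside all the \<open>D k i\<close> is removed at no stage, so it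
    passes from \<open>S 0\<close> through to \<open>S (Suc n)\<close>.\<close>
  have "j \<in> A (Suc n) \<union> (\<Union>k\<le>n. \<Union>i\<in>A (n - k). D k i)" if "j div R n \<in> A n" for j
  proof (rule ccontr)
    assume neg: "\<not> ?thesis"
    have "k \<le> Suc n \<Longrightarrow> ?c j \<in> S k" for k
    proof (induction k)
      case 0
      show ?case unfolding S(1) sub_cells[OF J] using that by blast
    next
      case (Suc k)
      then have k: "k \<le> n" "?c j \<in> S k" by auto
      have "?c j \<notin> E k J" if "J \<in> \<J> (n - k)" for J
        using that neg k(1) J[of "n - k"] by (auto simp: D_def)
      then show ?case using ES[OF k(1)] k(2) by blast
    qed
    then have "j \<in> A (Suc n)" by (simp add: A_def S(3))
    then show False using neg by blast
  qed
  then have "{j. j div R n \<in> A n} \<subseteq> A (Suc n) \<union> (\<Union>k\<le>n. \<Union>i\<in>A (n - k). D k i)"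
    by (intro subsetI) (simp only: mem_Collect_eq)
  moreover have "\<forall>k\<le>n. \<forall>i\<in>A (n - k). finite (D k i) \<and> real (card (D k i)) \<le> r (n - k) n \<and>
      (\<forall>j\<in>D k i. ?c j \<subseteq> cell a (h (n - k)) i)"
    using small by (intro allI impI ballI)
  ultimately show "\<exists>D. (\<forall>k\<le>n. \<forall>i\<in>A (n - k). finite (D k i) \<and> real (card (D k i)) \<le> r (n - k) n \<and>
             (\<forall>j\<in>D k i. ?c j \<subseteq> cell a (h (n - k)) i)) \<and>
           {j. j div R n \<in> A n} \<subseteq> A (Suc n) \<union> (\<Union>k\<le>n. \<Union>i\<in>A (n - k). D k i)"
    by (intro exI[of _ D] conjI)
qed

section \<open>Growth estimates for the counts and for products of the \<open>R n\<close>\<close>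

text \<open>The recursion is separated from the geometry: \<open>\<beta> n\<close> will count the
  intervals kept, and \<open>c n\<close> those discarded for meeting a ball. Each kind of loss takes
  at most a quarter of \<open>R n * \<beta> n\<close>, which leaves a growth factor of
  \<open>R n / 2\<close>.\<close>

lemma survivors_lower_bound:
  fixes \<beta> c :: "nat \<Rightarrow> real" and R :: "nat \<Rightarrow> nat"
  assumes R: "\<And>n. 0 < R n" and r: "\<And>m n. m \<le> n \<Longrightarrow> 0 \<le> r m n"
    and sum: "\<And>n. (\<Sum>k=0..n. r (n - k) n * (\<Prod>i=1..k. 4 / real (R (n - i)))) \<le> real (R n) / 4"
    and "\<beta> 0 = 1"
    and rec: "\<And>n. real (R n) * \<beta> n \<le> \<beta> (Suc n) + (\<Sum>k\<le>n. r (n - k) n * \<beta> (n - k)) + c n"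
    and c: "\<And>n. c n \<le> (\<Prod>i\<le>n. real (R i) / 2) / 2"
  shows "(\<Prod>i<n. real (R i) / 2) \<le> \<beta> n"
proof -
  \<comment> \<open>The growth inequalities of all earlier levels are carried along, because the
    removal terms in \<open>rec\<close> reach back to every one of them.\<close>
  have "(\<Prod>i<n. real (R i) / 2) \<le> \<beta> n \<and> (\<forall>m<n. real (R m) / 2 * \<beta> m \<le> \<beta> (Suc m))"
  proof (induction n)
    case 0
    show ?case using \<open>\<beta> 0 = 1\<close> by simp
  next
    case (Suc n)
    have "0 < (\<Prod>i<n. real (R i) / 2)" using R by (intro prod_pos) auto
    with Suc have \<beta>_pos: "0 < \<beta> n" by linarith
    have growth: "real (R m) / 2 * \<beta> m \<le> \<beta> (Suc m)" if "m < n" for m using Suc that by blast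
    \<comment> \<open>Going back one level costs a factor 2/R, hence at most 4/R. So the products in
      the hypothesis \<open>sum\<close> bound the earlier counts in terms of
      \<open>\<beta> n\<close>.\<close>
    have earlier: "k \<le> n \<Longrightarrow> \<beta> (n - k) \<le> (\<Prod>i=1..k. 4 / real (R (n - i))) * \<beta> n" for k
    proof (induction k)
      case (Suc k)
      let ?m = "n - Suc k" and ?p = "\<Prod>i=1..k. 4 / real (R (n - i))"
      have m: "Suc ?m = n - k" "?m < n" using Suc.prems by auto
      have p: "0 \<le> ?p" by (intro prod_nonneg) auto
      have "real (R ?m) / 2 * \<beta> ?m \<le> \<beta> (n - k)"
        using growth m by metis
      also have "\<dots> \<le> ?p * \<beta> n" using Suc by simp
      finally have "\<beta> ?m \<le> 2 / real (R ?m) * (?p * \<beta> n)"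
        using R[of ?m] by (simp add: field_simps)
      also have "\<dots> \<le> 4 / real (R ?m) * (?p * \<beta> n)"
        using p \<beta>_pos by (intro mult_right_mono divide_right_mono) auto
      finally show ?case by (simp add: ac_simps)
    qed simp
    have "(\<Sum>k\<le>n. r (n - k) n * \<beta> (n - k)) \<le>
        (\<Sum>k\<le>n. r (n - k) n * ((\<Prod>i=1..k. 4 / real (R (n - i))) * \<beta> n))"
      using r earlier by (intro sum_mono mult_left_mono) auto
    also have "\<dots> = (\<Sum>k=0..n. r (n - k) n * (\<Prod>i=1..k. 4 / real (R (n - i)))) * \<beta> n"
      by (simp add: sum_distrib_right mult.assoc atMost_atLeast0)
    also have "\<dots> \<le> real (R n) / 4 * \<beta> n" using sum \<beta>_pos by (intro mult_right_mono) auto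
    finally have removed: "(\<Sum>k\<le>n. r (n - k) n * \<beta> (n - k)) \<le> real (R n) / 4 * \<beta> n" .
    have "(\<Prod>i\<le>n. real (R i) / 2) = real (R n) / 2 * (\<Prod>i<n. real (R i) / 2)"
      by (simp flip: lessThan_Suc_atMost)
    also have "\<dots> \<le> real (R n) / 2 * \<beta> n" using Suc by (intro mult_left_mono) auto
    finally have "(\<Prod>i\<le>n. real (R i) / 2) \<le> real (R n) / 2 * \<beta> n" .
    with c[of n] have "c n \<le> real (R n) / 4 * \<beta> n" by simp
    with removed rec[of n] have half: "real (R n) / 2 * \<beta> n \<le> \<beta> (Suc n)" by simp
    have "(\<Prod>i<Suc n. real (R i) / 2) = real (R n) / 2 * (\<Prod>i<n. real (R i) / 2)" by simp
    also have "\<dots> \<le> real (R n) / 2 * \<beta> n" using Suc by (intro mult_left_mono) auto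
    finally show ?case using half Suc by (auto simp: less_Suc_eq)
  qed
  then show ?thesis by simp
qed

text \<open>Taking logarithms, s < 1 - ln 2 / ln R amounts to R^(1 - s) > 2. This holds from some
  level N on, so the power of the product at least doubles with each level; the constant 2^(-N) pays
  for the first N levels.\<close>

lemma prod_powr_ge:
  fixes R :: "nat \<Rightarrow> nat"
  assumes R: "\<And>n. 1 < R n" and "ereal s < liminf (\<lambda>n. ereal (1 - ln 2 / ln (real (R n))))"
  shows "s < 1" and "\<exists>c>0. \<forall>n. c * 2 ^ n \<le> (\<Prod>i<n. real (R i)) powr (1 - s)"
proof -
  obtain N where N: "\<And>n. N \<le> n \<Longrightarrow> s < 1 - ln 2 / ln (real (R n))"
    using less_LiminfD[OF assms(2)] by (auto simp: eventually_sequentially)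
  have ln_pos: "0 < ln (real (R n))" for n using R[of n] by simp
  have "0 < ln 2 / ln (real (R N))" using ln_pos by simp
  then show "s < 1" using N[of N] by linarith
  have two: "2 \<le> real (R n) powr (1 - s)" if "N \<le> n" for n
  proof -
    have "ln 2 \<le> (1 - s) * ln (real (R n))"
      using N[OF that] ln_pos[of n] by (simp add: field_simps)
    then have "exp (ln 2) \<le> exp ((1 - s) * ln (real (R n)))" by (simp only: exp_le_cancel_iff)
    then show ?thesis using R[of n] by (simp add: powr_def exp_ln del: exp_le_cancel_iff)
  qed
  have "1 / 2 ^ N * 2 ^ n \<le> (\<Prod>i<n. real (R i)) powr (1 - s)" for n
  proof (induction n)
    case (Suc n)
    let ?P = "\<Prod>i<n. real (R i)"
    show ?case
    proof (cases "N \<le> n")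
      case True
      have "1 / 2 ^ N * 2 ^ Suc n = (1 / 2 ^ N * 2 ^ n) * (2::real)" by simp
      also have "\<dots> \<le> ?P powr (1 - s) * real (R n) powr (1 - s)"
        using Suc two[OF True] by (intro mult_mono) auto
      also have "\<dots> = (\<Prod>i<Suc n. real (R i)) powr (1 - s)"
        by (simp add: powr_mult prod_nonneg)
      finally show ?thesis .
    next
      case False
      have "1 \<le> (\<Prod>i<Suc n. real (R i))" using R by (intro prod_ge_1) (simp add: less_imp_le)
      then have "1 \<le> (\<Prod>i<Suc n. real (R i)) powr (1 - s)"
        using \<open>s < 1\<close> by (intro ge_one_powr_ge_zero) auto
      moreover have "(2::real) ^ Suc n \<le> 2 ^ N" using False by (intro power_increasing) auto
      then have "1 / 2 ^ N * 2 ^ Suc n \<le> (1::real)" by (simp add: field_simps)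
      ultimately show ?thesis by linarith
    qed
  qed simp
  then show "\<exists>c>0. \<forall>n. c * 2 ^ n \<le> (\<Prod>i<n. real (R i)) powr (1 - s)"
    by (intro exI[of _ "1 / 2 ^ N"]) auto
qed

section \<open>Survivors that avoid a finite family of balls\<close>

text \<open>A sum within the bound would have two effects: every radius is less than b - a, so each
  ball has a scale, and the cells discarded at each level stay within the quota of
  \<open>survivors_lower_bound\<close>. In the 16, a factor 4 is the constant of the cell count, a
  factor 2 is the half in the quota, and the last 2 turns 2^n into 2^(n + 1).\<close>

lemma no_small_finite_ball_cover:
  fixes R :: "nat \<Rightarrow> nat"
  assumes "a < b" and r: "\<And>m n. m \<le> n \<Longrightarrow> 0 \<le> r m n"
    and "is_cantor_set {a..b} R r K" and R: "\<And>n. 2 \<le> R n"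
    and sum: "\<And>n. (\<Sum>k=0..n. r (n - k) n * (\<Prod>i=1..k. 4 / real (R (n - i)))) \<le> real (R n) / 4"
    and "0 < s" "s < 1" "0 < c"
    and c: "\<And>n. c * 2 ^ n \<le> (\<Prod>i<n. real (R i)) powr (1 - s)"
    and F: "finite F" "\<And>i. i \<in> F \<Longrightarrow> 0 < \<rho> i"
    and cover: "K \<subseteq> (\<Union>i\<in>F. ball (x i) (\<rho> i))"
  shows "c * (b - a) powr s / 16 < (\<Sum>i\<in>F. \<rho> i powr s)"
proof (rule ccontr)
  assume "\<not> ?thesis"
  then have small: "(\<Sum>i\<in>F. \<rho> i powr s) \<le> c * (b - a) powr s / 16" by simp
  obtain \<J> where constr: "cantor_construction {a..b} R r \<J>" and K: "K = (\<Inter>n\<in>{1..}. \<Union>(\<J> n))"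
    using \<open>is_cantor_set {a..b} R r K\<close> by (auto simp: is_cantor_set_def)
  have R_pos: "0 < R n" for n using R[of n] by simp
  define P where "P n = (\<Prod>i<n. real (R i))" for n
  define h where "h n = (b - a) / P n" for n
  have P_pos: "0 < P n" for n unfolding P_def using R_pos by (intro prod_pos) auto
  have h_pos: "0 < h n" for n using P_pos \<open>a < b\<close> by (simp add: h_def)
  have h_0: "h 0 = b - a" by (simp add: h_def P_def)
  have h_Suc: "h (Suc n) = h n / real (R n)" for n by (simp add: h_def P_def)
  define A where "A = indices a h \<J>"
  note facts = cantor_construction_indices[OF constr R_pos h_pos h_0 h_Suc, folded A_def]
  note A0 = facts(1) and JA = facts(2) and A_sub = facts(3) and A_removal = facts(4)
  have child_sub: "cell a (h (Suc n)) j \<subseteq> cell a (h n) (j div R n)" for n j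
    unfolding h_Suc by (rule cell_child_subset[OF h_pos R_pos])
  have A_finite: "finite (A n)" for n
  proof (induction n)
    case (Suc n)
    show ?case by (rule finite_subset[OF A_sub card_div_vimage(1)[OF Suc R_pos]])
  qed (simp add: A0)

  \<comment> \<open>The lower end makes the radius at least the mesh of level n + 1, as the cell
    count requires; the upper end lets \<open>h n\<close> bound the radius.\<close>
  define scale where "scale n = {i \<in> F. h (Suc n) \<le> \<rho> i \<and> \<rho> i < h n}" for n
  define C where "C n = (\<Union>i\<in>scale n. {j. cell a (h (Suc n)) j \<inter> ball (x i) (\<rho> i) \<noteq> {}})" for n
  \<comment> \<open>A cell is kept only if its parent is. So a member of \<open>B n\<close> avoids,
    through its ancestors, all balls of scale below n.\<close>
  define B where "B = rec_nat {0} (\<lambda>n X. {j \<in> A (Suc n). j div R n \<in> X \<and> j \<notin> C n})"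
  have B0: "B 0 = {0}" and B_Suc: "B (Suc n) = {j \<in> A (Suc n). j div R n \<in> B n \<and> j \<notin> C n}" for n
    by (simp_all add: B_def)
  have B_sub: "B n \<subseteq> A n" for n by (cases n) (auto simp: B0 A0 B_Suc)
  have B_finite: "finite (B n)" for n using finite_subset[OF B_sub A_finite] .
  have anc: "\<exists>i\<in>B m. cell a (h n) j \<subseteq> cell a (h m) i" if "m \<le> n" "j \<in> B n" for m n j
    using that
  proof (induction n arbitrary: j rule: dec_induct)
    case (step n)
    then have "j div R n \<in> B n" by (simp add: B_Suc)
    from step.IH[OF this] child_sub[of n j] show ?case by blast
  qed blast
  have scale_finite: "finite (scale n)" for n using F by (simp add: scale_def)
  have C_finite: "finite (C n)" for n
    unfolding C_def using scale_finite
    by (intro finite_UN_I card_cells_meeting_ball(1)[OF h_pos]) (auto simp: scale_def)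
  have C_card: "real (card (C n)) \<le> (\<Prod>i\<le>n. real (R i) / 2) / 2" for n
  proof -
    \<comment> \<open>As 1 - s > 0, the factor \<rho>^(1 - s) of the radius is traded for the same
      power of \<open>h n\<close>; a sum of s-th powers then controls the sum of radii.\<close>
    have radii: "\<rho> i \<le> \<rho> i powr s * h n powr (1 - s)" if "i \<in> scale n" for i
    proof -
      have "0 < \<rho> i" "\<rho> i < h n" using that F by (auto simp: scale_def)
      then have "\<rho> i powr s * \<rho> i powr (1 - s) \<le> \<rho> i powr s * h n powr (1 - s)"
        using \<open>s < 1\<close> by (intro mult_left_mono powr_mono2) auto
      then show ?thesis using \<open>0 < \<rho> i\<close> by (simp flip: powr_add)
    qed
    have "(\<Sum>i\<in>scale n. \<rho> i) \<le> (\<Sum>i\<in>scale n. \<rho> i powr s * h n powr (1 - s))"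
      by (intro sum_mono radii)
    also have "\<dots> = (\<Sum>i\<in>scale n. \<rho> i powr s) * h n powr (1 - s)" by (simp add: sum_distrib_right)
    also have "\<dots> \<le> (c * (b - a) powr s / 16) * h n powr (1 - s)"
    proof (rule mult_right_mono)
      have "(\<Sum>i\<in>scale n. \<rho> i powr s) \<le> (\<Sum>i\<in>F. \<rho> i powr s)"
        using F by (intro sum_mono2) (auto simp: scale_def)
      then show "(\<Sum>i\<in>scale n. \<rho> i powr s) \<le> c * (b - a) powr s / 16" using small by linarith
    qed simp
    also have "\<dots> = (b - a) * c / (16 * P n powr (1 - s))"
    proof -
      have "(b - a) powr s * (b - a) powr (1 - s) = b - a" using \<open>a < b\<close> by (simp flip: powr_add)
      then show ?thesis using \<open>a < b\<close> P_pos[of n] by (simp add: h_def powr_divide)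
    qed
    \<comment> \<open>The choice of s enters here, through the growth of P_n^(1 - s); afterwards
      \<open>c\<close> cancels.\<close>
    also have "\<dots> \<le> (b - a) * c / (16 * (c * 2 ^ n))"
      using c[of n] \<open>0 < c\<close> \<open>a < b\<close> P_pos[of n]
      by (intro divide_left_mono mult_left_mono mult_pos_pos) (auto simp: P_def R_pos)
    also have "\<dots> = (b - a) / (16 * 2 ^ n)" using \<open>0 < c\<close> by simp
    finally have sum_radii: "(\<Sum>i\<in>scale n. \<rho> i) \<le> (b - a) / (16 * 2 ^ n)" .
    have "real (card (C n)) \<le>
        (\<Sum>i\<in>scale n. real (card {j. cell a (h (Suc n)) j \<inter> ball (x i) (\<rho> i) \<noteq> {}}))"
      unfolding C_def of_nat_sum[symmetric] of_nat_le_iff by (rule card_UN_le[OF scale_finite])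
    also have "\<dots> \<le> (\<Sum>i\<in>scale n. 4 * \<rho> i / h (Suc n))"
      by (intro sum_mono card_cells_meeting_ball(2)[OF h_pos]) (auto simp: scale_def)
    also have "\<dots> = 4 / h (Suc n) * (\<Sum>i\<in>scale n. \<rho> i)" by (simp add: sum_distrib_left)
    also have "\<dots> \<le> 4 / h (Suc n) * ((b - a) / (16 * 2 ^ n))"
      using h_pos[of "Suc n"] by (intro mult_left_mono sum_radii) auto
    also have "\<dots> = P (Suc n) / 2 ^ Suc n / 2"
      using \<open>a < b\<close> P_pos[of "Suc n"] by (simp add: h_def)
    also have "P (Suc n) / 2 ^ Suc n = (\<Prod>i\<le>n. real (R i) / 2)"
      by (simp add: P_def prod_dividef lessThan_Suc_atMost del: prod.lessThan_Suc)
    finally show ?thesis .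
  qed
  have rec: "real (R n) * real (card (B n)) \<le>
      real (card (B (Suc n))) + (\<Sum>k\<le>n. r (n - k) n * real (card (B (n - k)))) + real (card (C n))" for n
  proof -
    obtain D where small: "\<forall>k\<le>n. \<forall>i\<in>A (n - k). finite (D k i) \<and> real (card (D k i)) \<le> r (n - k) n \<and>
               (\<forall>j\<in>D k i. cell a (h (Suc n)) j \<subseteq> cell a (h (n - k)) i)"
      and D_cover: "{j. j div R n \<in> A n} \<subseteq> A (Suc n) \<union> (\<Union>k\<le>n. \<Union>i\<in>A (n - k). D k i)"
      using A_removal[of n] by (elim exE conjE) (rule that)
    note D = small[rule_format]
    let ?U = "\<lambda>k. \<Union>i\<in>B (n - k). D k i"
    have U_finite: "finite (?U k)" if "k \<le> n" for k
      using B_finite D[OF that] B_sub by blast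
    have "{j. j div R n \<in> B n} \<subseteq> B (Suc n) \<union> (\<Union>k\<le>n. ?U k) \<union> C n"
    proof
      fix j assume "j \<in> {j. j div R n \<in> B n}"
      then have j: "j div R n \<in> B n" by simp
      show "j \<in> B (Suc n) \<union> (\<Union>k\<le>n. ?U k) \<union> C n"
      proof (cases "j \<in> A (Suc n)")
        case True
        then show ?thesis using j by (auto simp: B_Suc)
      next
        case False
        then obtain k i where ki: "k \<le> n" "i \<in> A (n - k)" "j \<in> D k i"
          using D_cover j B_sub[of n] by blast
        then have i: "cell a (h (Suc n)) j \<subseteq> cell a (h (n - k)) i" using D by blast
        obtain i' where i': "i' \<in> B (n - k)" "cell a (h n) (j div R n) \<subseteq> cell a (h (n - k)) i'"
          using anc[OF _ j, of "n - k"] by auto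
        \<comment> \<open>The interval charged with removing \<open>j\<close> and the ancestor of
          \<open>j\<close> in \<open>B\<close> both contain cell \<open>j\<close>, so they coincide.
          Hence only members of \<open>B\<close> are charged, and the recursion closes in terms of
          the cardinalities of the \<open>B n\<close>.\<close>
        have "i = i'"
          using cell_subset_unique[OF h_pos h_pos i] i'(2) child_sub[of n j] by blast
        then show ?thesis using ki i' by blast
      qed
    qed
    then have "card {j. j div R n \<in> B n} \<le> card (B (Suc n) \<union> (\<Union>k\<le>n. ?U k) \<union> C n)"
      using B_finite C_finite U_finite by (intro card_mono) auto
    also have "\<dots> \<le> card (B (Suc n)) + card (\<Union>k\<le>n. ?U k) + card (C n)"
      by (meson add_le_mono card_Un_le le_refl order_trans)
    also have "\<dots> \<le> card (B (Suc n)) + (\<Sum>k\<le>n. card (?U k)) + card (C n)"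
      by (intro add_mono card_UN_le order_refl finite_atMost)
    finally have "real (R n * card (B n)) \<le> real (card (B (Suc n)) + (\<Sum>k\<le>n. card (?U k)) + card (C n))"
      unfolding card_div_vimage(2)[OF B_finite R_pos] by (simp only: of_nat_le_iff)
    moreover have "(\<Sum>k\<le>n. real (card (?U k))) \<le> (\<Sum>k\<le>n. r (n - k) n * real (card (B (n - k))))"
    proof (rule sum_mono)
      fix k assume "k \<in> {..n}"
      then have k: "k \<le> n" by simp
      have "real (card (?U k)) \<le> (\<Sum>i\<in>B (n - k). real (card (D k i)))"
        unfolding of_nat_sum[symmetric] of_nat_le_iff by (rule card_UN_le[OF B_finite])
      also have "\<dots> \<le> (\<Sum>i\<in>B (n - k). r (n - k) n)" using D[OF k] B_sub by (intro sum_mono) blast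
      finally show "real (card (?U k)) \<le> r (n - k) n * real (card (B (n - k)))"
        by (simp add: mult.commute)
    qed
    ultimately show ?thesis by simp
  qed
  have "(\<Prod>i<n. real (R i) / 2) \<le> real (card (B n))" for n
    by (rule survivors_lower_bound[OF R_pos r sum _ rec C_card]) (simp_all add: B0)
  moreover have "0 < (\<Prod>i<n. real (R i) / 2)" for n using R_pos by (intro prod_pos) auto
  ultimately have B_nonempty: "B n \<noteq> {}" for n by (metis card.empty less_le_not_le of_nat_0)

  have scale_ex: "\<exists>m. i \<in> scale m" if "i \<in> F" for i
  proof -
    \<comment> \<open>The empty product at n = 0 gives this; it brings the radius below
      \<open>h 0\<close>.\<close>
    have "c \<le> 1" using c[of 0] by simp
    have "\<rho> i powr s \<le> (\<Sum>i\<in>F. \<rho> i powr s)" using F that by (intro member_le_sum) auto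
    also have "\<dots> \<le> c * (b - a) powr s / 16" by (rule small)
    also have "\<dots> < (b - a) powr s"
      using \<open>a < b\<close> mult_right_mono[OF \<open>c \<le> 1\<close>, of "(b - a) powr s"] by simp
    finally have "\<rho> i powr s < (b - a) powr s" .
    then have lt: "\<rho> i < h 0"
      unfolding h_0 using powr_mono2[of s "b - a" "\<rho> i"] \<open>0 < s\<close> \<open>a < b\<close> by linarith
    have h_le: "h n \<le> (b - a) * (1 / 2) ^ n" for n
    proof (induction n)
      case (Suc n)
      have "h (Suc n) \<le> h n / 2"
        unfolding h_Suc using R[of n] h_pos[of n] by (intro divide_left_mono) auto
      also have "\<dots> \<le> (b - a) * (1 / 2) ^ Suc n" using Suc by simp
      finally show ?case .
    qed (simp add: h_0)
    have "0 < \<rho> i / (b - a)" using F(2)[OF that] \<open>a < b\<close> by simp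
    then obtain n where "(1 / 2) ^ n < \<rho> i / (b - a)"
      using real_arch_pow_inv[of "\<rho> i / (b - a)" "1 / 2"] by auto
    then have "(b - a) * (1 / 2) ^ n < \<rho> i" using \<open>a < b\<close> by (simp add: field_simps)
    then have ex: "\<exists>n. h n \<le> \<rho> i" using h_le[of n] by (intro exI[of _ n]) linarith
    \<comment> \<open>The first level whose mesh is at most the radius is not 0, and its predecessor
      is the scale of the ball.\<close>
    define n where "n = (LEAST n. h n \<le> \<rho> i)"
    have n: "h n \<le> \<rho> i" unfolding n_def using ex by (rule LeastI_ex)
    then have "n \<noteq> 0" using lt by (metis not_le)
    then obtain m where m: "n = Suc m" by (meson not0_implies_Suc)
    have "\<not> h m \<le> \<rho> i" using not_less_Least[of m "\<lambda>n. h n \<le> \<rho> i"] m by (simp add: n_def)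
    then show ?thesis using n m that by (intro exI[of _ m]) (simp add: scale_def)
  qed
  then obtain sc where sc: "\<And>i. i \<in> F \<Longrightarrow> i \<in> scale (sc i)" by metis
  let ?W = "\<Union>i\<in>F. ball (x i) (\<rho> i)"
  have J_antimono: "\<Union>(\<J> n) \<subseteq> \<Union>(\<J> m)" if "m \<le> n" for m n
    using that
  proof (induction n rule: dec_induct)
    case (step n)
    have "\<Union>(\<J> (Suc n)) \<subseteq> \<Union>(\<J> n)"
      unfolding JA using A_sub[of n] child_sub[of n] by blast
    then show ?case using step by blast
  qed simp
  have "\<Union>(\<J> n) - ?W \<noteq> {}" for n
  proof -
    \<comment> \<open>The sum bounds every single scale, so a survivor of level \<open>N\<close>
      avoids all the balls; since \<open>N\<close> exceeds n, it also lies in the union of level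
      n.\<close>
    define N where "N = n + Suc (\<Sum>i\<in>F. sc i)"
    obtain j where j: "j \<in> B N" using B_nonempty by blast
    have "cell a (h N) j \<inter> ball (x i) (\<rho> i) = {}" if "i \<in> F" for i
    proof -
      have "sc i \<le> (\<Sum>i\<in>F. sc i)" using F that by (intro member_le_sum) auto
      then obtain j' where j': "j' \<in> B (Suc (sc i))" "cell a (h N) j \<subseteq> cell a (h (Suc (sc i))) j'"
        using anc[OF _ j, of "Suc (sc i)"] by (auto simp: N_def)
      then show ?thesis using sc[OF that] by (auto simp: B_Suc C_def)
    qed
    moreover have "cell a (h N) j \<subseteq> \<Union>(\<J> n)"
      using J_antimono[of n N] j B_sub[of N] by (auto simp: JA N_def)
    ultimately show ?thesis using cell_nonempty[OF h_pos, of a N j] by blast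
  qed
  moreover have "compact (\<Union>(\<J> n) - ?W)" for n
    by (intro compact_diff cantor_construction_compact[OF constr]) auto
  \<comment> \<open>Nested nonempty compact sets have a common point, which lies in \<open>K\<close>
    and in no ball.\<close>
  ultimately have "\<Inter>(range (\<lambda>n. \<Union>(\<J> n) - ?W)) \<noteq> {}"
    using J_antimono by (intro compact_nest Diff_mono order_refl)
  then obtain y where "y \<in> \<Inter>(range (\<lambda>n. \<Union>(\<J> n) - ?W))" by (meson ex_in_conv)
  then have y: "y \<in> \<Union>(\<J> n) - ?W" for n by (rule INT_D) simp
  then have "y \<in> K" unfolding K by (intro INT_I) (rule DiffD1)
  with cover have "y \<in> ?W" by (rule subsetD)
  with y show False by (rule DiffD2)
qed

section \<open>Hausdorff measure zero, covers by balls, and the dimension\<close>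

text \<open>A single mesh suffices: the premeasure for \<delta> = 1 is below the supremum and
  vanishes with it. The value 1 is arbitrary.\<close>

lemma hausdorff_measure_zero_cover:
  assumes "hausdorff_measure s K = 0" and "0 < \<epsilon>"
  obtains U where "K \<subseteq> (\<Union>i. U i)" "\<And>i. bounded (U i)" "(\<Sum>i. ennreal (diam_pow s (U i))) < ennreal \<epsilon>"
proof -
  have "hausdorff_premeasure 1 s K \<le> hausdorff_measure s K"
    unfolding hausdorff_measure_def by (rule SUP_upper) simp
  then have "hausdorff_premeasure 1 s K < ennreal \<epsilon>" using assms by (simp add: order_le_less_trans)
  then obtain U where "U \<in> delta_covers 1 K" "(\<Sum>i. ennreal (diam_pow s (U i))) < ennreal \<epsilon>"
    unfolding hausdorff_premeasure_def INF_less_iff by blast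
  then show thesis by (intro that[of U]) (auto simp: delta_covers_def)
qed

lemma diam_pow_nonneg: "0 \<le> diam_pow s U"
  by (simp add: diam_pow_def)

lemma sum_diam_pow_less:
  assumes "(\<Sum>i. ennreal (diam_pow s (U i))) < ennreal \<epsilon>" "finite F"
  shows "(\<Sum>i\<in>F. diam_pow s (U i)) < \<epsilon>"
proof -
  have "ennreal (\<Sum>i\<in>F. diam_pow s (U i)) = (\<Sum>i\<in>F. ennreal (diam_pow s (U i)))"
    by (intro sum_ennreal[symmetric] diam_pow_nonneg)
  also have "\<dots> \<le> (\<Sum>i. ennreal (diam_pow s (U i)))"
    using assms(2) by (intro sum_le_suminf) auto
  also have "\<dots> < ennreal \<epsilon>" by (rule assms(1))
  finally show ?thesis by (simp add: ennreal_less_iff sum_nonneg diam_pow_nonneg)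
qed

text \<open>For s = 0 every nonempty set has weight 1, so a total weight below 1 forces all covering
  sets to be empty.\<close>

lemma hausdorff_measure_0_eq_0:
  assumes "hausdorff_measure 0 K = 0"
  shows "K = {}"
proof -
  obtain U where U: "K \<subseteq> (\<Union>i. U i)" "(\<Sum>i. ennreal (diam_pow 0 (U i))) < ennreal 1"
    using hausdorff_measure_zero_cover[OF assms zero_less_one] by metis
  have "U i = {}" for i
    using sum_diam_pow_less[OF U(2), of "{i}"] by (auto simp: diam_pow_def split: if_splits)
  then show ?thesis using U(1) by simp
qed

text \<open>A bounded set lies in the open ball about any of its points whose radius exceeds the
  diameter. The surplus \<open>e i\<close> makes the radius exceed the diameter and stay positive
  even for points and empty sets, at a total cost of \<epsilon>/2.\<close>

lemma hausdorff_measure_zero_ball_cover: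
  fixes K :: "'a::metric_space set"
  assumes "hausdorff_measure s K = 0" "0 < s" "0 < \<epsilon>"
  obtains x \<rho> where "K \<subseteq> (\<Union>i::nat. ball (x i) (\<rho> i))" "\<And>i. 0 < \<rho> i"
    "\<And>F. finite F \<Longrightarrow> (\<Sum>i\<in>F. \<rho> i powr s) < \<epsilon>"
proof -
  obtain U where U: "K \<subseteq> (\<Union>i. U i)" "\<And>i. bounded (U i)"
    "(\<Sum>i. ennreal (diam_pow s (U i))) < ennreal (\<epsilon> / 2)"
    using hausdorff_measure_zero_cover[OF assms(1), of "\<epsilon> / 2"] \<open>0 < \<epsilon>\<close> by auto
  define e where "e i = \<epsilon> / 2 * (1 / 2) ^ Suc i" for i
  \<comment> \<open>The exponent 1/s makes the s-th power of the radius exactly the weight plus the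
    surplus.\<close>
  define \<rho> where "\<rho> i = (diam_pow s (U i) + e i) powr (1 / s)" for i
  define x where "x i = (SOME x. x \<in> U i)" for i
  have e_pos: "0 < e i" for i using \<open>0 < \<epsilon>\<close> by (simp add: e_def)
  have base_pos: "0 < diam_pow s (U i) + e i" for i
    using e_pos[of i] diam_pow_nonneg[of s "U i"] by linarith
  show thesis
  proof
    show "0 < \<rho> i" for i using base_pos[of i] by (simp add: \<rho>_def)
    show "K \<subseteq> (\<Union>i. ball (x i) (\<rho> i))"
    proof
      fix y assume "y \<in> K"
      then obtain i where y: "y \<in> U i" using U(1) by blast
      then have "x i \<in> U i" unfolding x_def by (rule someI)
      then have "dist (x i) y \<le> diameter (U i)" using U(2) y by (intro diameter_bounded_bound)
      also have "\<dots> = (diameter (U i) powr s) powr (1 / s)"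
        using \<open>0 < s\<close> diameter_ge_0[OF U(2)] by (simp add: powr_powr)
      also have "\<dots> < \<rho> i"
        unfolding \<rho>_def using y \<open>0 < s\<close> e_pos[of i]
        by (intro powr_less_mono2) (auto simp: diam_pow_def)
      finally show "y \<in> (\<Union>i. ball (x i) (\<rho> i))" by auto
    qed
    fix F :: "nat set" assume F: "finite F"
    have e_sums: "e sums (\<epsilon> / 2)"
      using sums_mult[OF power_half_series, of "\<epsilon> / 2"] by (simp add: e_def[abs_def])
    have "(\<Sum>i\<in>F. \<rho> i powr s) = (\<Sum>i\<in>F. diam_pow s (U i)) + (\<Sum>i\<in>F. e i)"
      using base_pos \<open>0 < s\<close> by (simp add: \<rho>_def powr_powr sum.distrib less_imp_le)
    moreover have "(\<Sum>i\<in>F. e i) \<le> \<epsilon> / 2"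
      using sum_le_suminf[OF sums_summable[OF e_sums] F] e_pos sums_unique[OF e_sums]
      by (simp add: less_imp_le)
    ultimately show "(\<Sum>i\<in>F. \<rho> i powr s) < \<epsilon>"
      using sum_diam_pow_less[OF U(3) F] by linarith
  qed
qed

theorem theorem4:
  fixes a b :: real and R :: "nat \<Rightarrow> nat" and r :: "nat \<Rightarrow> nat \<Rightarrow> real" and K :: "real set"
  assumes "a < b"
    and "\<And>m n. m \<le> n \<Longrightarrow> 0 \<le> r m n"
    and "is_cantor_set {a..b} R r K"
    and "\<And>n. 4 \<le> R n"
    and "\<And>n. (\<Sum>k=0..n. r (n - k) n * (\<Prod>i=1..k. 4 / real (R (n - i)))) \<le> real (R n) / 4"
  shows "hausdorff_dim K \<ge> liminf (\<lambda>n. ereal (1 - ln 2 / ln (real (R n))))"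
  unfolding hausdorff_dim_def
proof (rule Inf_greatest, clarify)
  fix s :: real assume s: "0 \<le> s" and zero: "hausdorff_measure s K = 0"
  have R: "0 < R n" "1 < R n" "2 \<le> R n" for n using assms(4)[of n] by auto
  show "liminf (\<lambda>n. ereal (1 - ln 2 / ln (real (R n)))) \<le> ereal s"
  proof (rule ccontr)
    assume "\<not> ?thesis"
    then have s_less: "ereal s < liminf (\<lambda>n. ereal (1 - ln 2 / ln (real (R n))))" by simp
    \<comment> \<open>The exponent \<open>t\<close> is kept for the case s = 0: the bound on covers
      requires a positive exponent.\<close>
    then obtain t where t: "ereal s < ereal t" "ereal t < liminf (\<lambda>n. ereal (1 - ln 2 / ln (real (R n))))"
      using ereal_dense2 by blast
    have no_cover: "\<exists>\<epsilon>>0. \<forall>F x \<rho>. finite F \<longrightarrow> (\<forall>i\<in>F. 0 < \<rho> i) \<longrightarrow>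
        K \<subseteq> (\<Union>i\<in>F. ball (x i) (\<rho> i)) \<longrightarrow> \<epsilon> < (\<Sum>i\<in>(F::nat set). \<rho> i powr u)"
      if "0 < u" "ereal u < liminf (\<lambda>n. ereal (1 - ln 2 / ln (real (R n))))" for u
    proof -
      note u = prod_powr_ge[OF R(2) that(2)]
      obtain c where c: "0 < c" "\<And>n. c * 2 ^ n \<le> (\<Prod>i<n. real (R i)) powr (1 - u)"
        using u(2) by blast
      have "0 < c * (b - a) powr u / 16" using c(1) \<open>a < b\<close> by simp
      moreover have "c * (b - a) powr u / 16 < (\<Sum>i\<in>F. \<rho> i powr u)"
        if "finite F" "\<forall>i\<in>F. 0 < \<rho> i" "K \<subseteq> (\<Union>i\<in>F. ball (x i) (\<rho> i))" for F :: "nat set" and x \<rho>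
        using no_small_finite_ball_cover[OF assms(1-3) R(3) assms(5) \<open>0 < u\<close> u(1) c that(1) _ that(3)]
          that(2) by simp
      ultimately show ?thesis by (intro exI[of _ "c * (b - a) powr u / 16"]) simp
    qed
    show False
    proof (cases "s = 0")
      case True
      \<comment> \<open>The empty family of balls now covers \<open>K\<close> with sum 0, which
        contradicts the bound at the exponent \<open>t\<close>.\<close>
      then have "K = {}" using zero hausdorff_measure_0_eq_0 by blast
      have "0 < t" using t(1) True by simp
      obtain \<epsilon> where "0 < \<epsilon>" and \<epsilon>: "\<forall>F x \<rho>. finite F \<longrightarrow> (\<forall>i\<in>F. 0 < \<rho> i) \<longrightarrow>
        K \<subseteq> (\<Union>i\<in>F. ball (x i) (\<rho> i)) \<longrightarrow> \<epsilon> < (\<Sum>i\<in>(F::nat set). \<rho> i powr t)"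
        using no_cover[OF \<open>0 < t\<close> t(2)] by (elim exE conjE)
      show False using \<open>0 < \<epsilon>\<close> \<epsilon>[rule_format, of "{}" "\<lambda>_. 1" "\<lambda>_. 0"] \<open>K = {}\<close> by simp
    next
      case False
      then have "0 < s" using s by simp
      obtain \<epsilon> where "0 < \<epsilon>" and \<epsilon>: "\<forall>F x \<rho>. finite F \<longrightarrow> (\<forall>i\<in>F. 0 < \<rho> i) \<longrightarrow>
        K \<subseteq> (\<Union>i\<in>F. ball (x i) (\<rho> i)) \<longrightarrow> \<epsilon> < (\<Sum>i\<in>(F::nat set). \<rho> i powr s)"
        using no_cover[OF \<open>0 < s\<close> s_less] by (elim exE conjE)
      obtain x \<rho> where x: "K \<subseteq> (\<Union>i::nat. ball (x i) (\<rho> i))" "\<And>i. 0 < \<rho> i"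
        "\<And>F. finite F \<Longrightarrow> (\<Sum>i\<in>F. \<rho> i powr s) < \<epsilon>"
        by (rule hausdorff_measure_zero_ball_cover[OF zero \<open>0 < s\<close> \<open>0 < \<epsilon>\<close>]) blast
      have "compact K" using compact_cantor_set[OF assms(3)] .
      then obtain F where F: "finite F" "K \<subseteq> (\<Union>i\<in>F. ball (x i) (\<rho> i))"
        using compactE_image[of K UNIV "\<lambda>i. ball (x i) (\<rho> i)"] x(1) by auto
      show False using \<epsilon>[rule_format, OF F(1) x(2) F(2)] x(3)[OF F(1)] by simp
    qed
  qed
qed

end
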